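(* For a benchmark of $n$ approximately independent trials at improvement ratio $r$, the clean sheet and the single observed harm carry equal evidence at $$p^{\times}\;\approx\;\frac{\ln(1/r)}{2n(1-r)}\;=\;\tfrac12\,p_{\min}(r,n,r),$$ with the clean sheet the more informative observation above $p^{\times}$ and the single harm the more informative below it. At $n=520$, $r=0.5$ this gives $p^{\times}=1.33\times10^{-3}$; at $n=10^{5}$ (with $r=0.5$) it gives $p^{\times}=6.93\times10^{-6}$.
   Context: A benchmark consists of $n$ trials (prompts), each of which is or is not harmful under a fixed scoring rule; "approximately independent" is used informally, without a quantitative definition. Two hypotheses are compared: $H_1$ (elevated risk), under which the harm rate is $p$, and $H_0$ (acceptable risk), under which it is $rp$, where $r\in(0,1)$ is the improvement ratio. The clean sheet is the outcome of zero harmful outputs in $n$ trials, with likelihood ratio $P(\cdot\mid H_1)/P(\cdot\mid H_0)$ equal to $\Lambda_0=[(1-p)/(1-rp)]^{n}$; the single observed harm is the outcome of one harmful output in $n$ trials, with likelihood ratio $\Lambda_1=(1/r)[(1-p)/(1-rp)]^{n-1}$. The evidence carried by an observation with likelihood ratio $\Lambda$ is $|\log_2\Lambda|$ bits, and the more informative of two observations is the one carrying more evidence. "Above" and "below" $p^{\times}$ refer to the rate $p$. For a threshold $\tau$ and a trial ceiling $N$, $p_{\min}(\tau,N,r)$ denotes the rate obtained by setting $[(1-p)/(1-rp)]^{N}=\tau$ and solving for $p$, given to first order by $p_{\min}(\tau,N,r)\approx-\ln\tau/(N(1-r))$; here it is evaluated at $\tau=r$, $N=n$. The sign $\approx$ denotes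 a first-order (small $p$) approximation. *)

theory Defs
  imports "HOL-Probability.Probability" "HOL-Library.Landau_Symbols"
begin

text \<open>
  The trials are modelled as independent, so that the number of harmful outputs in \<open>n\<close> trials is
  binomially distributed, with harm rate \<open>p\<close> under the elevated-risk hypothesis and \<open>r * p\<close> under
  the acceptable-risk hypothesis. The likelihood ratio is that of observing exactly \<open>k\<close> harms.
\<close>

definition likelihood_ratio :: "nat \<Rightarrow> real \<Rightarrow> real \<Rightarrow> nat \<Rightarrow> real" where
  "likelihood_ratio n r p k = pmf (binomial_pmf n p) k / pmf (binomial_pmf n (r * p)) k"

definition evidence_bits :: "real \<Rightarrow> real" where
  "evidence_bits \<Lambda> = \<bar>log 2 \<Lambda>\<bar>"

definition clean_sheet_evidence :: "nat \<Rightarrow> real \<Rightarrow> real \<Rightarrow> real" where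
  "clean_sheet_evidence n r p = evidence_bits (likelihood_ratio n r p 0)"

definition single_harm_evidence :: "nat \<Rightarrow> real \<Rightarrow> real \<Rightarrow> real" where
  "single_harm_evidence n r p = evidence_bits (likelihood_ratio n r p 1)"

definition p_cross :: "nat \<Rightarrow> real \<Rightarrow> real" where
  "p_cross n r = (THE p. 0 < p \<and> p < 1 \<and> clean_sheet_evidence n r p = single_harm_evidence n r p)"

definition p_min :: "real \<Rightarrow> nat \<Rightarrow> real \<Rightarrow> real" where
  "p_min \<tau> N r = (THE p. 0 < p \<and> p < 1 \<and> ((1 - p) / (1 - r * p)) ^ N = \<tau>)"

text \<open>The solution of the defining equation of \<open>p_min\<close> after \<open>ln ((1 - p) / (1 - r * p))\<close> is
  replaced by its linear part \<open>- (1 - r) * p\<close>.\<close>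

definition p_min_first_order :: "real \<Rightarrow> nat \<Rightarrow> real \<Rightarrow> real" where
  "p_min_first_order \<tau> N r = - ln \<tau> / (real N * (1 - r))"

lemma likelihood_ratio_clean_sheet:
  assumes "0 < r" "r < 1" "0 < p" "p < 1"
  shows "likelihood_ratio n r p 0 = ((1 - p) / (1 - r * p)) ^ n"
proof -
  have "r * p < 1" using assms mult_strict_mono[of r 1 p 1] by simp
  then show ?thesis
    using assms by (simp add: likelihood_ratio_def power_divide)
qed

lemma likelihood_ratio_single_harm:
  assumes "1 \<le> n" "0 < r" "r < 1" "0 < p" "p < 1"
  shows "likelihood_ratio n r p 1 = (1 / r) * ((1 - p) / (1 - r * p)) ^ (n - 1)"
proof -
  have "r * p < 1" using assms mult_strict_mono[of r 1 p 1] by simp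
  then show ?thesis
    using assms by (simp add: likelihood_ratio_def power_divide)
qed

lemma p_min_solves:
  assumes "1 \<le> N" "0 < r" "r < 1" "0 < \<tau>" "\<tau> < 1"
  shows "0 < p_min \<tau> N r" "p_min \<tau> N r < 1"
    and "((1 - p_min \<tau> N r) / (1 - r * p_min \<tau> N r)) ^ N = \<tau>"
proof -
  define q where "q = root N \<tau>"
  have q: "0 < q" "q < 1" "q ^ N = \<tau>"
    using assms by (auto simp: q_def)
  have rq: "r * q < q" "r * q < 1"
    using assms q mult_strict_mono[of r 1 q 1] by auto
  define p0 where "p0 = (1 - q) / (1 - r * q)"
  have p0: "0 < p0" "p0 < 1"
    using q rq by (auto simp: p0_def)
  have iff: "(1 - p) / (1 - r * p) = q \<longleftrightarrow> p = p0" if "0 < p" "p < 1" for p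
  proof -
    have "r * p < 1" using assms that mult_strict_mono[of r 1 p 1] by simp
    then show ?thesis using rq by (auto simp: p0_def field_simps)
  qed
  have "\<exists>!p. 0 < p \<and> p < 1 \<and> ((1 - p) / (1 - r * p)) ^ N = \<tau>"
  proof (rule ex1I[of _ p0])
    show "0 < p0 \<and> p0 < 1 \<and> ((1 - p0) / (1 - r * p0)) ^ N = \<tau>"
      using p0 iff q by auto
  next
    fix p assume p: "0 < p \<and> p < 1 \<and> ((1 - p) / (1 - r * p)) ^ N = \<tau>"
    have "r * p < 1" using assms p mult_strict_mono[of r 1 p 1] by simp
    then have "0 \<le> (1 - p) / (1 - r * p)" using p by simp
    then have "(1 - p) / (1 - r * p) = q"
      using p q assms power_eq_iff_eq_base[of N "(1 - p) / (1 - r * p)" q]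
      by (metis less_eq_real_def less_le_trans zero_less_one power_eq_imp_eq_base)
    then show "p = p0" using iff p by blast
  qed
  from theI'[OF this] show "0 < p_min \<tau> N r" "p_min \<tau> N r < 1"
    and "((1 - p_min \<tau> N r) / (1 - r * p_min \<tau> N r)) ^ N = \<tau>"
    unfolding p_min_def by auto
qed

end

theory Submission
  imports Defs "HOL-Real_Asymp.Real_Asymp"
begin

text \<open>
  Let \<open>L\<close> be the evidence, in nats, of a single harmless trial. The clean sheet carries \<open>n * L\<close>
  nats and the single harm \<open>\<bar>ln (1 / r) - (n - 1) * L\<bar>\<close>, so they balance exactly when
  \<open>(2 * n - 1) * L = ln (1 / r)\<close>; that is, the crossing point is \<open>p_min r (2 * n - 1) r\<close>. As
  \<open>L / (1 - r)\<close> lies between \<open>p\<close> and \<open>p / (1 - p)\<close>, everything about small rates follows. Replacing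
  \<open>2 * n - 1\<close> by \<open>2 * n\<close> costs only a second-order error because \<open>ln (1 / r) \<ge> 1 - r\<close> forces the
  crossing point to be at least of order \<open>1 / (2 * n)\<close>.
\<close>

section \<open>Evidence of one harmless trial: linear bounds and monotonicity in the rate\<close>

definition trial_evidence :: "real \<Rightarrow> real \<Rightarrow> real" where
  "trial_evidence r p = ln ((1 - r * p) / (1 - p))"

context
  fixes r :: real
  assumes r: "0 < r" "r < 1"
begin

lemma mult_rate_less_one:
  assumes "0 < p" "p < 1"
  shows "r * p < 1"
  using r assms mult_strict_mono[of r 1 p 1] by simp

lemma ln_harmless_ratio:
  assumes "0 < p" "p < 1"
  shows "ln ((1 - p) / (1 - r * p)) = - trial_evidence r p"
  using assms mult_rate_less_one[OF assms] by (simp add: trial_evidence_def ln_div)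

text \<open>From \<open>ln x <= x - 1\<close> at \<open>x = (1 - r * p) / (1 - p)\<close>, whose
  excess over 1 is \<open>(1 - r) * p / (1 - p)\<close>.\<close>

lemma trial_evidence_le:
  assumes "0 < p" "p < 1"
  shows "trial_evidence r p / (1 - r) \<le> p / (1 - p)"
proof -
  have "trial_evidence r p \<le> (1 - r * p) / (1 - p) - 1"
    unfolding trial_evidence_def using assms mult_rate_less_one[OF assms]
    by (intro ln_le_minus_one) simp
  also have "\<dots> = (1 - r) * (p / (1 - p))"
    using assms by (simp add: field_simps)
  finally show ?thesis using r by (simp add: pos_divide_le_eq mult.commute)
qed

text \<open>The same inequality at the reciprocal ratio; the resulting denominator
  \<open>1 - r * p\<close> lies between 0 and 1, so dropping it only weakens the bound.\<close>

lemma trial_evidence_ge: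
  assumes "0 < p" "p < 1"
  shows "p \<le> trial_evidence r p / (1 - r)"
proof -
  note rp = mult_rate_less_one[OF assms]
  have "- trial_evidence r p \<le> (1 - p) / (1 - r * p) - 1"
    unfolding ln_harmless_ratio[OF assms, symmetric] using assms rp
    by (intro ln_le_minus_one) simp
  also have "\<dots> = - ((1 - r) * p / (1 - r * p))"
    using rp by (simp add: field_simps)
  also have "\<dots> \<le> - ((1 - r) * p)"
    using r assms rp by (simp add: pos_le_divide_eq mult_left_le)
  finally show ?thesis using r by (simp add: pos_le_divide_eq mult.commute)
qed

lemma trial_evidence_strict_mono:
  assumes "0 < p" "p < p'" "p' < 1"
  shows "trial_evidence r p < trial_evidence r p'"
proof -
  have "r * p < 1" "r * p' < 1" using mult_rate_less_one assms by auto
  \<comment> \<open>This product is exactly the difference of the two cross-multiplied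
    sides.\<close>
  moreover have "0 < (1 - r) * (p' - p)" using r assms by simp
  then have "(1 - r * p) * (1 - p') < (1 - r * p') * (1 - p)" by (simp add: algebra_simps)
  ultimately have "(1 - r * p) / (1 - p) < (1 - r * p') / (1 - p')"
    using assms by (simp add: divide_simps mult.commute)
  then show ?thesis
    unfolding trial_evidence_def using assms \<open>r * p < 1\<close> \<open>r * p' < 1\<close> by (subst ln_less_cancel_iff) auto
qed

lemma trial_evidence_less_iff:
  assumes "0 < p" "p < 1" "0 < p'" "p' < 1"
  shows "trial_evidence r p < trial_evidence r p' \<longleftrightarrow> p < p'"
  using assms trial_evidence_strict_mono by (metis linorder_neqE_linordered_idom order_less_asym)

section \<open>Evidence of the two observations and their crossing point\<close>

lemma clean_sheet_evidence_eq:
  assumes "0 < p" "p < 1"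
  shows "clean_sheet_evidence n r p = real n * trial_evidence r p / ln 2"
proof -
  have "0 \<le> trial_evidence r p"
    using trial_evidence_ge[OF assms] r assms by (simp add: pos_le_divide_eq) (smt (verit) mult_pos_pos)
  then show ?thesis
    using assms mult_rate_less_one[OF assms] r ln_harmless_ratio[OF assms]
    by (simp add: clean_sheet_evidence_def evidence_bits_def likelihood_ratio_clean_sheet
        log_def ln_realpow abs_mult abs_divide)
qed

text \<open>The absolute value stays: the factor \<open>1 / r\<close> favours elevated risk, the
  harmless trials favour acceptable risk, and either may dominate. Dividing by \<open>ln 2\<close>
  turns nats into bits.\<close>

lemma single_harm_evidence_eq:
  assumes "1 \<le> n" "0 < p" "p < 1"
  shows "single_harm_evidence n r p = \<bar>ln (1 / r) - (real n - 1) * trial_evidence r p\<bar> / ln 2"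
proof -
  have "ln (1 / r * ((1 - p) / (1 - r * p)) ^ (n - 1)) =
      ln (1 / r) + real (n - 1) * ln ((1 - p) / (1 - r * p))"
    using assms mult_rate_less_one[of p] r by (subst ln_mult_pos) (auto simp: ln_realpow)
  then show ?thesis
    using assms r ln_harmless_ratio[of p]
    by (simp only: single_harm_evidence_def evidence_bits_def likelihood_ratio_single_harm log_def)
      (simp add: of_nat_diff abs_divide)
qed

text \<open>Logarithm of the equation defining \<open>p_min\<close> at threshold \<open>r\<close>:
  there \<open>N\<close> harmless trials exactly offset the factor \<open>1 / r\<close>.\<close>

lemma trial_evidence_p_min:
  assumes "1 \<le> N"
  shows "real N * trial_evidence r (p_min r N r) = ln (1 / r)"
proof -
  note s = p_min_solves[OF assms r r]
  have "ln r = real N * ln ((1 - p_min r N r) / (1 - r * p_min r N r))"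
    using s mult_rate_less_one[OF s(1,2)] by (subst s(3)[symmetric], subst ln_realpow) auto
  then show ?thesis using ln_harmless_ratio[OF s(1,2)] r by (simp add: ln_div)
qed

lemma evidence_order:
  assumes "1 \<le> n" "0 < p" "p < 1"
  shows "clean_sheet_evidence n r p < single_harm_evidence n r p \<longleftrightarrow> p < p_min r (2 * n - 1) r"
    and "single_harm_evidence n r p < clean_sheet_evidence n r p \<longleftrightarrow> p_min r (2 * n - 1) r < p"
proof -
  define p0 where "p0 = p_min r (2 * n - 1) r"
  define L where "L = trial_evidence r"
  have N: "1 \<le> 2 * n - 1" using assms by simp
  note s = p_min_solves[OF N r r, folded p0_def]
  have N': "real (2 * n - 1) = 2 * real n - 1" using assms by (simp add: of_nat_diff)
  have eq: "ln (1 / r) = (2 * real n - 1) * L p0"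
    unfolding p0_def L_def N'[symmetric] using trial_evidence_p_min[OF N] by (rule sym)
  have pos: "0 < L p" using trial_evidence_ge[OF assms(2,3)] r assms
    by (simp add: L_def pos_le_divide_eq) (smt (verit) mult_pos_pos)
  have n: "real n \<ge> 1" using assms by simp
  have nL: "0 \<le> (real n - 1) * L p" using n pos by simp
  have M: "0 < ln (1 / r)" using r by simp
  have cl: "clean_sheet_evidence n r p < single_harm_evidence n r p \<longleftrightarrow>
      real n * L p < \<bar>ln (1 / r) - (real n - 1) * L p\<bar>"
    and sh: "single_harm_evidence n r p < clean_sheet_evidence n r p \<longleftrightarrow>
      \<bar>ln (1 / r) - (real n - 1) * L p\<bar> < real n * L p"
    using assms by (simp_all add: clean_sheet_evidence_eq single_harm_evidence_eq L_def divide_less_cancel)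
  \<comment> \<open>If the harmless trials dominate, the right side is
    \<open>(n - 1) * L p - ln (1 / r)\<close>, which is below \<open>n * L p\<close>, while
    \<open>(2 * n - 1) * L p\<close> exceeds \<open>ln (1 / r)\<close>: both sides of the
    equivalence fail. Only the other sign needs rearranging.\<close>
  have "real n * L p < \<bar>ln (1 / r) - (real n - 1) * L p\<bar> \<longleftrightarrow> (2 * real n - 1) * L p < ln (1 / r)"
    using nL pos M by (auto simp: abs_if algebra_simps)
  also have "\<dots> \<longleftrightarrow> p < p0"
    unfolding eq using n trial_evidence_less_iff[of p p0] assms s by (simp add: L_def)
  finally show "clean_sheet_evidence n r p < single_harm_evidence n r p \<longleftrightarrow> p < p_min r (2 * n - 1) r"
    unfolding cl p0_def .
  have "\<bar>ln (1 / r) - (real n - 1) * L p\<bar> < real n * L p \<longleftrightarrow> ln (1 / r) < (2 * real n - 1) * L p"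
    using nL pos M by (auto simp: abs_if algebra_simps)
  also have "\<dots> \<longleftrightarrow> p0 < p"
    unfolding eq using n trial_evidence_less_iff[of p0 p] assms s by (simp add: L_def)
  finally show "single_harm_evidence n r p < clean_sheet_evidence n r p \<longleftrightarrow> p_min r (2 * n - 1) r < p"
    unfolding sh p0_def .
qed

text \<open>Away from this \<open>p_min\<close>, one of the two strict orders holds; at it, neither
  does. So it is the unique rate of equal evidence.\<close>

lemma p_cross_eq_p_min:
  assumes "1 \<le> n"
  shows "p_cross n r = p_min r (2 * n - 1) r"
proof -
  have N: "1 \<le> 2 * n - 1" using assms by simp
  note s = p_min_solves[OF N r r]
  show ?thesis
    unfolding p_cross_def using s evidence_order[OF assms]
    by (intro the_equality) (metis less_irrefl linorder_neqE_linordered_idom)+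
qed

lemma p_cross_threshold:
  assumes "1 \<le> n"
  shows "0 < p_cross n r \<and> p_cross n r < 1 \<and>
    (\<forall>p. 0 < p \<and> p < 1 \<longrightarrow>
       (clean_sheet_evidence n r p = single_harm_evidence n r p \<longleftrightarrow> p = p_cross n r) \<and>
       (p_cross n r < p \<longrightarrow> single_harm_evidence n r p < clean_sheet_evidence n r p) \<and>
       (p < p_cross n r \<longrightarrow> clean_sheet_evidence n r p < single_harm_evidence n r p)) \<and>
    ln (1 / r) / (2 * real n * (1 - r)) = 1 / 2 * p_min_first_order r n r"
proof (intro conjI allI impI; (elim conjE)?)
  note c = p_cross_eq_p_min[OF assms]
  have N: "1 \<le> 2 * n - 1" using assms by simp
  note s = p_min_solves[OF N r r, folded c]
  show "0 < p_cross n r" "p_cross n r < 1" using s by auto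
  show "ln (1 / r) / (2 * real n * (1 - r)) = 1 / 2 * p_min_first_order r n r"
    using r by (simp add: p_min_first_order_def ln_div)
  fix p :: real assume p: "0 < p" "p < 1"
  note o = evidence_order[OF assms p, folded c]
  show "clean_sheet_evidence n r p = single_harm_evidence n r p \<longleftrightarrow> p = p_cross n r"
    using o by (metis less_irrefl linorder_neqE_linordered_idom)
  show "single_harm_evidence n r p < clean_sheet_evidence n r p" if "p_cross n r < p"
    using o that by simp
  show "clean_sheet_evidence n r p < single_harm_evidence n r p" if "p < p_cross n r"
    using o that by simp
qed

section \<open>First-order approximation with explicit error\<close>

text \<open>At \<open>p_min\<close> the quantity \<open>trial_evidence / (1 - r)\<close> is the
  first-order value itself, so the linear bounds apply to it directly. The third bound is the second
  one solved for \<open>p_min\<close>.\<close>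

lemma p_min_bounds:
  assumes "1 \<le> N"
  shows "p_min r N r \<le> p_min_first_order r N r"
    and "p_min_first_order r N r \<le> p_min r N r / (1 - p_min r N r)"
    and "p_min_first_order r N r / (1 + p_min_first_order r N r) \<le> p_min r N r"
proof -
  note s = p_min_solves[OF assms r r]
  have X: "trial_evidence r (p_min r N r) / (1 - r) = p_min_first_order r N r"
    using trial_evidence_p_min[OF assms] assms r
    by (simp add: p_min_first_order_def ln_div field_simps)
  show lo: "p_min r N r \<le> p_min_first_order r N r"
    using trial_evidence_ge[OF s(1,2)] X by simp
  show hi: "p_min_first_order r N r \<le> p_min r N r / (1 - p_min r N r)"
    using trial_evidence_le[OF s(1,2)] X by simp
  show "p_min_first_order r N r / (1 + p_min_first_order r N r) \<le> p_min r N r"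
    using lo hi s(1,2) by (simp add: field_simps)
qed

lemma p_min_first_order_error:
  assumes "1 \<le> N" "p_min r N r < 1 / 2"
  shows "\<bar>p_min r N r - p_min_first_order r N r\<bar> \<le> 2 * (p_min r N r)\<^sup>2"
proof -
  note s = p_min_solves[OF assms(1) r r]
  have "p_min r N r / (1 - p_min r N r) - p_min r N r = (p_min r N r)\<^sup>2 / (1 - p_min r N r)"
    using s by (simp add: field_simps power2_eq_square)
  also have "\<dots> \<le> (p_min r N r)\<^sup>2 / (1 / 2)"
    using assms by (intro divide_left_mono) auto
  finally show ?thesis using p_min_bounds[OF assms(1)] by simp
qed

text \<open>The constant splits as 2 + 4: 2 for linearising with exponent \<open>2 * n - 1\<close>
  (\<open>p\<close> against \<open>X\<close>), 4 for replacing \<open>2 * n - 1\<close> by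
  \<open>2 * n\<close> (\<open>X\<close> against \<open>Y\<close>).\<close>

lemma p_cross_first_order_error:
  assumes "1 \<le> n" "p_cross n r < 1 / 2"
  shows "\<bar>p_cross n r - ln (1 / r) / (2 * real n * (1 - r))\<bar> \<le> 6 * (p_cross n r)\<^sup>2"
proof -
  define p where "p = p_cross n r"
  define X where "X = p_min_first_order r (2 * n - 1) r"
  define Y where "Y = ln (1 / r) / (2 * real n * (1 - r))"
  have N: "1 \<le> 2 * n - 1" using assms by simp
  have p: "p = p_min r (2 * n - 1) r" unfolding p_def using assms(1) by (rule p_cross_eq_p_min)
  note s = p_min_solves[OF N r r, folded p]
  have pX: "\<bar>p - X\<bar> \<le> 2 * p\<^sup>2"
    using p_min_first_order_error[OF N] assms by (simp add: p X_def p_def[symmetric])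
  have "p / (1 - p) \<le> p / (1 / 2)" using s assms by (intro divide_left_mono) (auto simp: p_def)
  then have X2: "X \<le> 2 * p"
    using p_min_bounds(2)[OF N, folded p X_def] by simp
  have n: "real n \<ge> 1" using assms by simp
  have N': "real (2 * n - 1) = 2 * real n - 1" using assms by (simp add: of_nat_diff)
  have X: "X = ln (1 / r) / ((2 * real n - 1) * (1 - r))"
    unfolding X_def p_min_first_order_def N' using r by (simp add: ln_div)
  \<comment> \<open>This makes the constant independent of \<open>r\<close>: it gives
    \<open>1 / (2 * n - 1) <= X\<close>, hence \<open>1 / (2 * n) <= 2 * p\<close>.\<close>
  have "1 - r \<le> ln (1 / r)" using ln_le_minus_one[of r] r by (simp add: ln_div)
  then have "1 \<le> ln (1 / r) / (1 - r)" using r by (simp add: pos_le_divide_eq)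
  then have "1 / (2 * real n - 1) \<le> ln (1 / r) / (1 - r) / (2 * real n - 1)"
    using n by (intro divide_right_mono) auto
  then have "1 / (2 * real n - 1) \<le> X" by (simp add: X mult.commute)
  moreover have "1 / (2 * real n) \<le> 1 / (2 * real n - 1)"
    using n by (simp add: field_simps)
  ultimately have "X * (1 / (2 * real n)) \<le> (2 * p) * (2 * p)"
    using X2 s n by (intro mult_mono) auto
  moreover have "X - Y = X * (1 / (2 * real n))"
    unfolding X Y_def using n r by (simp add: divide_simps) (simp add: algebra_simps)
  moreover have "0 \<le> X * (1 / (2 * real n))"
    using p_min_bounds(1)[OF N, folded p X_def] s n by simp
  ultimately show ?thesis using pX by (simp add: p_def[symmetric] Y_def[symmetric] power2_eq_square)
qed

section \<open>Asymptotics for many trials\<close>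

text \<open>Sandwich between \<open>X / (1 + X)\<close> and \<open>X\<close>, with \<open>X\<close>
  tending to 0. The general \<open>N\<close> covers both \<open>n\<close> and
  \<open>2 * n - 1\<close>.\<close>

lemma p_min_asymp_equiv:
  assumes "filterlim N at_top F"
  shows "(\<lambda>n. p_min r (N n) r) \<sim>[F] (\<lambda>n. p_min_first_order r (N n) r)"
proof -
  define X where "X = (\<lambda>N. p_min_first_order r N r)"
  have "(\<lambda>N. p_min r N r) \<sim>[at_top] X"
  proof (rule asymp_equiv_sandwich_real)
    have "0 < - ln r" using r by simp
    then show "(\<lambda>N. X N / (1 + X N)) \<sim>[at_top] X"
      unfolding X_def p_min_first_order_def using r by real_asymp
    show "\<forall>\<^sub>F N in at_top. p_min r N r \<in> {X N / (1 + X N)..X N}"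
      using eventually_ge_at_top[of 1]
      by eventually_elim (use p_min_bounds in \<open>auto simp: X_def\<close>)
  qed simp
  from asymp_equiv_compose'[OF this assms] show ?thesis by (simp add: X_def)
qed

lemma p_cross_asymp_equiv:
  shows "(\<lambda>n. p_cross n r) \<sim>[at_top] (\<lambda>n. ln (1 / r) / (2 * real n * (1 - r)))"
    and "(\<lambda>n. p_cross n r) \<sim>[at_top] (\<lambda>n. 1 / 2 * p_min r n r)"
proof -
  have M: "0 < - ln r" using r by simp
  \<comment> \<open>Only eventual, since at \<open>n = 0\<close> the natural number
    \<open>2 * n - 1\<close> truncates to 0.\<close>
  have ev: "\<forall>\<^sub>F n in at_top. p_min r (2 * n - 1) r = p_cross n r"
    using eventually_ge_at_top[of 1] by eventually_elim (rule p_cross_eq_p_min[symmetric])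
  have "filterlim (\<lambda>n::nat. 2 * n - 1) at_top at_top" by real_asymp
  from asymp_equiv_transfer[OF p_min_asymp_equiv[OF this] ev]
  have "(\<lambda>n. p_cross n r) \<sim>[at_top] (\<lambda>n. p_min_first_order r (2 * n - 1) r)"
    by simp
  also have "(\<lambda>n. p_min_first_order r (2 * n - 1) r) \<sim>[at_top] (\<lambda>n. - ln r / (2 * real n * (1 - r)))"
    unfolding p_min_first_order_def using M r by real_asymp
  also have "- ln r = ln (1 / r)" using r by (simp add: ln_div)
  finally show *: "(\<lambda>n. p_cross n r) \<sim>[at_top] (\<lambda>n. ln (1 / r) / (2 * real n * (1 - r)))" .
  have "(\<lambda>n. 1 / 2 * p_min r n r) \<sim>[at_top] (\<lambda>n. 1 / 2 * p_min_first_order r n r)"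
    by (intro asymp_equiv_intros p_min_asymp_equiv filterlim_ident)
  also have "(\<lambda>n. 1 / 2 * p_min_first_order r n r) = (\<lambda>n. ln (1 / r) / (2 * real n * (1 - r)))"
    using r by (simp add: p_min_first_order_def ln_div fun_eq_iff)
  finally show "(\<lambda>n. p_cross n r) \<sim>[at_top] (\<lambda>n. 1 / 2 * p_min r n r)"
    using * asymp_equiv_sym asymp_equiv_trans by blast
qed

end

section \<open>Numerical values at improvement ratio one half\<close>

text \<open>For the rounding checks at both benchmark sizes it suffices that \<open>ln 2\<close>
  lies between 0.6926 and 0.6934.\<close>

lemma ln_2_bounds: "0.693 < ln (2::real)" "ln (2::real) < 0.6932"
  using ln_approx_bounds[of 2 3] by (simp_all add: eval_nat_numeral)

text \<open>The bounds \<open>X\<close> and \<open>X / (1 + X)\<close> at \<open>r = 0.5\<close>,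
  where \<open>X = 2 * ln 2 / (2 * n - 1)\<close>.\<close>

lemma p_cross_half_bounds:
  assumes "1 \<le> n"
  shows "p_cross n 0.5 \<le> 2 * ln 2 / (2 * real n - 1)"
    and "2 * ln 2 / (2 * real n - 1 + 2 * ln 2) \<le> p_cross n 0.5"
proof -
  have N: "1 \<le> 2 * n - 1" using assms by simp
  have n: "real n \<ge> 1" using assms by simp
  have X: "p_min_first_order 0.5 (2 * n - 1) 0.5 = 2 * ln 2 / (2 * real n - 1)"
    using assms by (simp add: p_min_first_order_def of_nat_diff ln_div)
  note b = p_min_bounds[of "0.5", OF _ _ N, unfolded X]
  have c: "p_cross n 0.5 = p_min 0.5 (2 * n - 1) 0.5" using assms by (intro p_cross_eq_p_min) auto
  show "p_cross n 0.5 \<le> 2 * ln 2 / (2 * real n - 1)" using b(1) c by simp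
  have "2 * ln 2 / (2 * real n - 1 + 2 * ln 2) =
      2 * ln 2 / (2 * real n - 1) / (1 + 2 * ln 2 / (2 * real n - 1))"
    using n by (simp add: divide_simps)
  then show "2 * ln 2 / (2 * real n - 1 + 2 * ln 2) \<le> p_cross n 0.5" using b(3) c by simp
qed

text \<open>Each tolerance is half a unit in the last quoted digit, so both the first-order formula
  and the exact crossing point round to the quoted value.\<close>

lemma p_cross_numerical:
  shows "\<bar>ln (1 / 0.5) / (2 * real 520 * (1 - 0.5)) - 1.33 / 10 ^ 3\<bar> < (0.005 / 10 ^ 3 :: real)"
    and "\<bar>p_cross 520 0.5 - 1.33 / 10 ^ 3\<bar> < 0.005 / 10 ^ 3"
    and "\<bar>ln (1 / 0.5) / (2 * real (10 ^ 5) * (1 - 0.5)) - 6.93 / 10 ^ 6\<bar> < (0.005 / 10 ^ 6 :: real)"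
    and "\<bar>p_cross (10 ^ 5) 0.5 - 6.93 / 10 ^ 6\<bar> < 0.005 / 10 ^ 6"
proof -
  note l = ln_2_bounds
  show "\<bar>ln (1 / 0.5) / (2 * real 520 * (1 - 0.5)) - 1.33 / 10 ^ 3\<bar> < (0.005 / 10 ^ 3 :: real)"
    using l by (simp add: abs_less_iff)
  show "\<bar>ln (1 / 0.5) / (2 * real (10 ^ 5) * (1 - 0.5)) - 6.93 / 10 ^ 6\<bar> < (0.005 / 10 ^ 6 :: real)"
    using l by (simp add: abs_less_iff)
  have "1.325 / 10 ^ 3 < 2 * ln 2 / (2 * real 520 - 1 + 2 * ln 2)"
    using l by (simp add: field_simps)
  moreover have "2 * ln 2 / (2 * real 520 - 1) < 1.335 / 10 ^ 3"
    using l by simp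
  ultimately show "\<bar>p_cross 520 0.5 - 1.33 / 10 ^ 3\<bar> < 0.005 / 10 ^ 3"
    using p_cross_half_bounds[of 520] unfolding abs_less_iff by auto
  have "6.925 / 10 ^ 6 < 2 * ln 2 / (2 * real (10 ^ 5) - 1 + 2 * ln 2)"
    using l by (simp add: field_simps)
  moreover have "2 * ln 2 / (2 * real (10 ^ 5) - 1) < 6.935 / 10 ^ 6"
    using l by simp
  ultimately show "\<bar>p_cross (10 ^ 5) 0.5 - 6.93 / 10 ^ 6\<bar> < 0.005 / 10 ^ 6"
    using p_cross_half_bounds[of "10 ^ 5"] unfolding abs_less_iff by auto
qed

text \<open>The sign of approximation is made precise twice: as a second-order error for small
  rates, uniform in \<open>n\<close> and \<open>r\<close>, and as asymptotic equivalence in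
  \<open>n\<close> for fixed \<open>r\<close>.\<close>

theorem corollary1:
  shows
    "(\<forall>(n::nat) (r::real). 1 \<le> n \<and> 0 < r \<and> r < 1 \<longrightarrow>
        0 < p_cross n r \<and> p_cross n r < 1 \<and>
        (\<forall>p. 0 < p \<and> p < 1 \<longrightarrow>
           (clean_sheet_evidence n r p = single_harm_evidence n r p \<longleftrightarrow> p = p_cross n r) \<and>
           (p_cross n r < p \<longrightarrow> single_harm_evidence n r p < clean_sheet_evidence n r p) \<and>
           (p < p_cross n r \<longrightarrow> clean_sheet_evidence n r p < single_harm_evidence n r p)) \<and>
        ln (1 / r) / (2 * real n * (1 - r)) = 1 / 2 * p_min_first_order r n r) \<and>
     (\<exists>C \<delta>. 0 < \<delta> \<and> (\<forall>(n::nat) (r::real). 1 \<le> n \<and> 0 < r \<and> r < 1 \<longrightarrow>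
        (p_cross n r < \<delta> \<longrightarrow>
           \<bar>p_cross n r - ln (1 / r) / (2 * real n * (1 - r))\<bar> \<le> C * (p_cross n r)\<^sup>2) \<and>
        (p_min r n r < \<delta> \<longrightarrow>
           \<bar>p_min r n r - p_min_first_order r n r\<bar> \<le> C * (p_min r n r)\<^sup>2))) \<and>
     (\<forall>r::real. 0 < r \<and> r < 1 \<longrightarrow>
        (\<lambda>n. p_cross n r) \<sim>[at_top] (\<lambda>n. ln (1 / r) / (2 * real n * (1 - r))) \<and>
        (\<lambda>n. p_cross n r) \<sim>[at_top] (\<lambda>n. 1 / 2 * p_min r n r)) \<and>
     \<bar>ln (1 / 0.5) / (2 * real 520 * (1 - 0.5)) - 1.33 / 10 ^ 3\<bar> < (0.005 / 10 ^ 3 :: real) \<and>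
     \<bar>p_cross 520 0.5 - 1.33 / 10 ^ 3\<bar> < 0.005 / 10 ^ 3 \<and>
     \<bar>ln (1 / 0.5) / (2 * real (10 ^ 5) * (1 - 0.5)) - 6.93 / 10 ^ 6\<bar> < (0.005 / 10 ^ 6 :: real) \<and>
     \<bar>p_cross (10 ^ 5) 0.5 - 6.93 / 10 ^ 6\<bar> < 0.005 / 10 ^ 6"
proof (intro conjI)
  show "\<exists>C \<delta>. 0 < \<delta> \<and> (\<forall>(n::nat) (r::real). 1 \<le> n \<and> 0 < r \<and> r < 1 \<longrightarrow>
        (p_cross n r < \<delta> \<longrightarrow>
           \<bar>p_cross n r - ln (1 / r) / (2 * real n * (1 - r))\<bar> \<le> C * (p_cross n r)\<^sup>2) \<and>
        (p_min r n r < \<delta> \<longrightarrow>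
           \<bar>p_min r n r - p_min_first_order r n r\<bar> \<le> C * (p_min r n r)\<^sup>2))"
  \<comment> \<open>The crossing point dictates 6, while 2 would do for \<open>p_min\<close>; rates
    below \<open>1 / 2\<close> keep \<open>1 / (1 - p)\<close> below 2.\<close>
  proof (rule exI[of _ 6], rule exI[of _ "1 / 2"], intro conjI allI impI; (elim conjE)?)
    fix n :: nat and r :: real
    assume nr: "1 \<le> n" "0 < r" "r < 1"
    show "\<bar>p_cross n r - ln (1 / r) / (2 * real n * (1 - r))\<bar> \<le> 6 * (p_cross n r)\<^sup>2"
      if "p_cross n r < 1 / 2"
      using p_cross_first_order_error nr that by blast
    show "\<bar>p_min r n r - p_min_first_order r n r\<bar> \<le> 6 * (p_min r n r)\<^sup>2"
      if "p_min r n r < 1 / 2"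
      using p_min_first_order_error[OF nr(2,3,1) that] zero_le_power2[of "p_min r n r"] by linarith
  qed simp
qed (use p_cross_threshold p_cross_asymp_equiv p_cross_numerical in \<open>blast+\<close>)

end
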